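(* For every acute triangle $ABC$ in which $BC$ is strictly the shortest side ($a<b$ and $a<c$), the distances from vertex $A$ satisfy $$AX_3<AX_9<AX_{10}<AX_2<AX_1<AX_6<AX_4<AX_{19}<AX_{16}.$$ Equivalently, in the vertex order, $X_3\prec X_9\prec X_{10}\prec X_2\prec X_1\prec X_6\prec X_4\prec X_{19}\prec X_{16}$.
   Context: $X_n$ denotes the $n$-th triangle center listed in Kimberling's Encyclopedia of Triangle Centers (ETC), given by barycentric coordinates in terms of $a=BC$, $b=CA$, $c=AB$. The vertex order is defined by: $P\prec Q$ if $P$ is closer to $A$ than $Q$ in every acute triangle $ABC$ with shortest side $BC$ (i.e. $a<b$, $a<c$). *)

theory Defs
  imports "HOL-Analysis.Analysis"
begin

definition bary :: "real^2 \<Rightarrow> real^2 \<Rightarrow> real^2 \<Rightarrow> real \<Rightarrow> real \<Rightarrow> real \<Rightarrow> real^2" where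
  "bary A B C u v w = (1 / (u + v + w)) *\<^sub>R (u *\<^sub>R A + v *\<^sub>R B + w *\<^sub>R C)"

text \<open>Conway's S = twice the area, from the side lengths (Heron).\<close>
definition conway_S :: "real \<Rightarrow> real \<Rightarrow> real \<Rightarrow> real" where
  "conway_S a b c = sqrt ((a+b+c) * (-a+b+c) * (a-b+c) * (a+b-c)) / 2"

text \<open>First barycentric coordinate f(a,b,c) of ETC centre X_n (for the centres used);
  the full coordinates are f(a,b,c) : f(b,c,a) : f(c,a,b).\<close>
definition etc_coord :: "nat \<Rightarrow> real \<Rightarrow> real \<Rightarrow> real \<Rightarrow> real" where
  "etc_coord n a b c =
    (if n = 1 then a
     else if n = 2 then 1
     else if n = 3 then a^2 * (b^2 + c^2 - a^2)
     else if n = 4 then 1 / (b^2 + c^2 - a^2)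
     else if n = 6 then a^2
     else if n = 9 then a * (b + c - a)
     else if n = 10 then b + c
     else if n = 16 then a^2 * (sqrt 3 * ((b^2 + c^2 - a^2) / 2) - conway_S a b c)
     else if n = 19 then a / (b^2 + c^2 - a^2)
     else undefined)"

definition etc_center :: "nat \<Rightarrow> real^2 \<Rightarrow> real^2 \<Rightarrow> real^2 \<Rightarrow> real^2" where
  "etc_center n A B C =
    (let a = dist B C; b = dist C A; c = dist A B in
     bary A B C (etc_coord n a b c) (etc_coord n b c a) (etc_coord n c a b))"

text \<open>Acute triangle: nondegenerate and every angle < pi/2, i.e. (law of cosines)
  the square of each side is less than the sum of the squares of the other two.\<close>
definition acute_triangle :: "real^2 \<Rightarrow> real^2 \<Rightarrow> real^2 \<Rightarrow> bool" where
  "acute_triangle A B C \<longleftrightarrow> \<not> collinear {A, B, C} \<and>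
     (dist B C)^2 < (dist C A)^2 + (dist A B)^2 \<and>
     (dist C A)^2 < (dist A B)^2 + (dist B C)^2 \<and>
     (dist A B)^2 < (dist B C)^2 + (dist C A)^2"

end

theory Submission
  imports Defs
begin

text \<open>
  By symmetry let \<open>b \<le> c\<close>. The point with barycentric coordinates \<open>u : v : w\<close> has squared distance
  \<open>(c\<^sup>2 v\<^sup>2 + b\<^sup>2 w\<^sup>2 + (b\<^sup>2 + c\<^sup>2 - a\<^sup>2) v w) / (u + v + w)\<^sup>2\<close> from \<open>A\<close>, so each comparison is a
  polynomial inequality, and a linear change of variables exhibits it as a polynomial with positive
  coefficients in nonnegative variables. For the steps from \<open>X\<^sub>3\<close> to \<open>X\<^sub>6\<close> one writes
  \<open>a = 2m + e\<close>, \<open>b = a + d\<close>, \<open>c = b + m\<close>; acuteness gives \<open>2a(c - b) < (b + c)(c - b) < a\<^sup>2\<close>,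
  hence \<open>e > 0\<close>. For the later steps one uses \<open>a\<^sup>2 = q + r\<close>, \<open>b\<^sup>2 = p + r\<close>, \<open>c\<^sup>2 = p + q\<close> with
  \<open>0 < r \<le> q < p\<close>. For \<open>X\<^sub>1\<^sub>9\<close> the products \<open>ab\<close>, \<open>ac\<close>, \<open>bc\<close> are estimated by AM-GM and
  \<open>bc \<ge> b\<^sup>2\<close>. Finally \<open>AX\<^sub>1\<^sub>6\<^sup>2 = b\<^sup>2 c\<^sup>2 / (p + q + r - \<surd>3 S)\<close>, and \<open>\<surd>3 S \<ge> 3 (q + r) / 2\<close> because
  \<open>a\<close> is the shortest side.
\<close>

section \<open>Polynomial inequalities in the side lengths\<close>

text \<open>Trades the quadratic acuteness condition for the linear \<open>2*(c - b) < a\<close>.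
  The resulting cone has free coordinates, so positive coefficients suffice there; it also contains
  obtuse triangles.\<close>

lemma acute_side_increments:
  fixes a b c :: real
  assumes "0 < a" "a < b" "b \<le> c" "c\<^sup>2 < a\<^sup>2 + b\<^sup>2"
  obtains m e d where "0 \<le> m" "0 < e" "0 < d" "a = 2*m + e" "b = 2*m + e + d" "c = 3*m + e + d"
proof (rule that[of "c - b" "a - 2*(c - b)" "b - a"])
  have "2*a*(c - b) \<le> (b + c)*(c - b)"
    using assms by (intro mult_right_mono) auto
  also have "\<dots> < a*a"
    using assms(4) by (simp add: power2_eq_square algebra_simps)
  finally have "a*(2*(c - b)) < a*a"
    by (simp add: mult.assoc mult.left_commute)
  then show "0 < a - 2*(c - b)"
    using assms(1) by simp
qed (use assms in auto)

text \<open>\<open>AX_3^2 < AX_9^2\<close>, cleared of denominators and divided by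
  \<open>b*c\<close>. Acuteness enters twice: through the cone and through
  \<open>a^2 + b^2 - c^2 > 0\<close>.\<close>

lemma mittenpunkt_sq_gt_poly:
  fixes a b c :: real
  assumes "0 < a" "a < b" "b \<le> c" "c\<^sup>2 < a\<^sup>2 + b\<^sup>2"
  shows "a^2*b*c*(2*(a*b + b*c + c*a) - a^2 - b^2 - c^2)^2
    < ((a+b+c)*(-a+b+c)*(a-b+c)*(a+b-c))
      * (b*c*((c+a-b)^2 + (a+b-c)^2) + (b^2+c^2-a^2)*(c+a-b)*(a+b-c))"
    (is "?L < ?R")
proof -
  obtain m e d where med: "0 \<le> m" "0 < e" "0 < d"
    and sides: "a = 2*m + e" "b = 2*m + e + d" "c = 3*m + e + d"
    using acute_side_increments[OF assms] .
  let ?Q = "181*m^8 + 1060*m^7*e + 480*m^7*d + 1983*m^6*e^2 + 2540*m^6*e*d + 352*m^6*d^2 +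
      1813*m^5*e^3 + 4523*m^5*e^2*d + 1676*m^5*e*d^2 + 64*m^5*d^3 + 928*m^4*e^4 +
      4006*m^4*e^3*d + 2671*m^4*e^2*d^2 + 288*m^4*e*d^3 + 274*m^3*e^5 + 2004*m^3*e^4*d +
      2052*m^3*e^3*d^2 + 400*m^3*e^2*d^3 + 44*m^2*e^6 + 580*m^2*e^5*d + 838*m^2*e^4*d^2
      + 248*m^2*e^3*d^3 + 3*m*e^7 + 91*m*e^6*d + 176*m*e^5*d^2 + 72*m*e^4*d^3 + 6*e^7*d
      + 15*e^6*d^2 + 8*e^5*d^3"
  \<comment> \<open>In \<open>m\<close>, \<open>e\<close>, \<open>d\<close> alone the difference has negative coefficients; the first summand, nonnegative by
    acuteness, absorbs them.\<close>
  have "?R - ?L = a^2*m*(b+c)^2*(b+c-2*a)*(a^2 - m*(b+c)) + ?Q"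
    unfolding sides by algebra
  moreover have "0 \<le> a^2*m*(b+c)^2*(b+c-2*a)*(a^2 - m*(b+c))"
  proof (intro mult_nonneg_nonneg)
    \<comment> \<open>Since \<open>m = c - b\<close>, this factor is
      \<open>a^2 + b^2 - c^2\<close>.\<close>
    show "0 \<le> a^2 - m*(b+c)"
      using assms(4) unfolding sides by (simp add: power2_eq_square algebra_simps)
  qed (use assms med in auto)
  \<comment> \<open>As \<open>m\<close> may vanish, strictness comes from the last monomial, which
    contains only \<open>e\<close> and \<open>d\<close>.\<close>
  moreover have "0 < ?Q"
    using med by (intro add_nonneg_pos add_nonneg_nonneg mult_nonneg_nonneg mult_pos_pos
        zero_le_power zero_less_power) auto
  ultimately show ?thesis by linarith
qed

text \<open>Here and in the next three lemmas, which clear denominators along X_9, X_10, X_2, X_1,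
  X_6 (the last divided by \<open>b*c\<close>), the expansion on the cone has only positive
  coefficients.\<close>

lemma spieker_sq_gt_mittenpunkt_sq_poly:
  fixes a b c :: real
  assumes "0 < a" "a < b" "b \<le> c" "c\<^sup>2 < a\<^sup>2 + b\<^sup>2"
  shows "b*c*(b*c*((c+a-b)^2 + (a+b-c)^2) + (b^2+c^2-a^2)*(c+a-b)*(a+b-c)) * (4*(a+b+c)^2)
    < (c^2*(c+a)^2 + b^2*(a+b)^2 + (b^2+c^2-a^2)*(c+a)*(a+b))
      * (2*(a*b + b*c + c*a) - a^2 - b^2 - c^2)^2"
    (is "?L < ?R")
proof -
  obtain m e d where med: "0 \<le> m" "0 < e" "0 < d"
    and sides: "a = 2*m + e" "b = 2*m + e + d" "c = 3*m + e + d"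
    using acute_side_increments[OF assms] .
  have "?R - ?L = 3213*m^8 + 11772*m^7*e + 13581*m^7*d + 17811*m^6*e^2 + 46260*m^6*e*d +
      17121*m^6*d^2 + 14474*m^5*e^3 + 64437*m^5*e^2*d + 52228*m^5*e*d^2 + 9192*m^5*d^3 +
      6851*m^4*e^4 + 47748*m^4*e^3*d + 63189*m^4*e^2*d^2 + 24448*m^4*e*d^3 +
      2196*m^4*d^4 + 1896*m^3*e^5 + 20391*m^3*e^4*d + 39072*m^3*e^3*d^2 +
      24528*m^3*e^2*d^3 + 4944*m^3*e*d^4 + 192*m^3*d^5 + 285*m^2*e^6 + 5028*m^2*e^5*d +
      13099*m^2*e^4*d^2 + 11728*m^2*e^3*d^3 + 3864*m^2*e^2*d^4 + 352*m^2*e*d^5 +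
      18*m*e^7 + 663*m*e^6*d + 2268*m*e^5*d^2 + 2696*m*e^4*d^3 + 1264*m*e^3*d^4 +
      192*m*e^2*d^5 + 36*e^7*d + 159*e^6*d^2 + 240*e^5*d^3 + 148*e^4*d^4 + 32*e^3*d^5"
    unfolding sides by algebra
  also have "\<dots> > 0"
    using med by (intro add_nonneg_pos add_nonneg_nonneg mult_nonneg_nonneg mult_pos_pos
        zero_le_power zero_less_power) auto
  finally show ?thesis by simp
qed

lemma centroid_sq_gt_spieker_sq_poly:
  fixes a b c :: real
  assumes "0 < a" "a < b" "b \<le> c" "c\<^sup>2 < a\<^sup>2 + b\<^sup>2"
  shows "9*(c^2*(c+a)^2 + b^2*(a+b)^2 + (b^2+c^2-a^2)*(c+a)*(a+b))
    < (2*b^2 + 2*c^2 - a^2) * (4*(a+b+c)^2)"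
    (is "?L < ?R")
proof -
  obtain m e d where med: "0 \<le> m" "0 < e" "0 < d"
    and sides: "a = 2*m + e" "b = 2*m + e + d" "c = 3*m + e + d"
    using acute_side_increments[OF assms] .
  have "?R - ?L = 91*m^4 + 172*m^3*e + 831*m^3*d + 99*m^2*e^2 + 936*m^2*e*d + 811*m^2*d^2 + 18*m*e^3
      + 333*m*e^2*d + 624*m*e*d^2 + 264*m*d^3 + 36*e^3*d + 117*e^2*d^2 + 104*e*d^3 +
      28*d^4"
    unfolding sides by algebra
  also have "\<dots> > 0"
    using med by (intro add_nonneg_pos add_nonneg_nonneg mult_nonneg_nonneg mult_pos_pos
        zero_le_power zero_less_power) auto
  finally show ?thesis by simp
qed

lemma incenter_sq_gt_centroid_sq_poly:
  fixes a b c :: real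
  assumes "0 < a" "a < b" "b \<le> c" "c\<^sup>2 < a\<^sup>2 + b\<^sup>2"
  shows "(2*b^2 + 2*c^2 - a^2)*(a+b+c) < 9*(b*c*(b+c-a))"
    (is "?L < ?R")
proof -
  obtain m e d where med: "0 \<le> m" "0 < e" "0 < d"
    and sides: "a = 2*m + e" "b = 2*m + e + d" "c = 3*m + e + d"
    using acute_side_increments[OF assms] .
  have "?R - ?L = 8*m^3 + 11*m^2*e + 59*m^2*d + 3*m*e^2 + 41*m*e*d + 49*m*d^2 + 6*e^2*d + 17*e*d^2 +
      10*d^3"
    unfolding sides by algebra
  also have "\<dots> > 0"
    using med by (intro add_nonneg_pos add_nonneg_nonneg mult_nonneg_nonneg mult_pos_pos
        zero_le_power zero_less_power) auto
  finally show ?thesis by simp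
qed

lemma symmedian_sq_gt_incenter_sq_poly:
  fixes a b c :: real
  assumes "0 < a" "a < b" "b \<le> c" "c\<^sup>2 < a\<^sup>2 + b\<^sup>2"
  shows "(b+c-a)*(a^2+b^2+c^2)^2 < b*c*(2*b^2 + 2*c^2 - a^2)*(a+b+c)"
    (is "?L < ?R")
proof -
  obtain m e d where med: "0 \<le> m" "0 < e" "0 < d"
    and sides: "a = 2*m + e" "b = 2*m + e + d" "c = 3*m + e + d"
    using acute_side_increments[OF assms] .
  have "?R - ?L = 57*m^5 + 121*m^4*e + 276*m^4*d + 88*m^3*e^2 + 466*m^3*e*d + 298*m^3*d^2 +
      27*m^2*e^3 + 277*m^2*e^2*d + 386*m^2*e*d^2 + 116*m^2*d^3 + 3*m*e^4 + 69*m*e^3*d +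
      159*m*e^2*d^2 + 104*m*e*d^3 + 16*m*d^4 + 6*e^4*d + 21*e^3*d^2 + 22*e^2*d^3 +
      8*e*d^4"
    unfolding sides by algebra
  also have "\<dots> > 0"
    using med by (intro add_nonneg_pos add_nonneg_nonneg mult_nonneg_nonneg mult_pos_pos
        zero_le_power zero_less_power) auto
  finally show ?thesis by simp
qed

section \<open>Polynomial inequalities in Conway's parameters\<close>

text \<open>\<open>AX_6^2 < AX_4^2\<close> without denominators. For ordered Conway parameters
  acuteness is exactly the linear condition \<open>0 < r\<close>, so this change of variables loses
  nothing.\<close>

lemma orthocenter_sq_gt_symmedian_sq_poly:
  fixes p q r :: real
  assumes "0 < r" "r \<le> q" "q < p"
  shows "(p+r)*(p+q)*(4*p+q+r)*(p*q+q*r+r*p) < (q+r)*p^2*(4*(p+q+r)^2)"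
    (is "?L < ?R")
proof -
  obtain x y where rxy: "0 < r" "0 \<le> x" "0 < y" and pq: "p = r + x + y" "q = r + x"
    using that[of "q - r" "p - q"] assms by auto
  have "?R - ?L = 6*x^5 + 15*x^4*y + 12*x^3*y^2 + 3*x^2*y^3 + 30*r*x^4 + 64*r*x^3*y + 42*r*x^2*y^2 +
      8*r*x*y^3 + 54*r^2*x^3 + 103*r^2*x^2*y + 57*r^2*x*y^2 + 8*r^2*y^3 + 42*r^3*x^2 +
      78*r^3*x*y + 30*r^3*y^2 + 12*r^4*x + 24*r^4*y"
    unfolding pq by algebra
  \<comment> \<open>As \<open>x\<close> may vanish, strictness comes from
    \<open>24*r^4*y\<close>.\<close>
  also have "\<dots> > 0"
    using rxy by (intro add_nonneg_pos add_nonneg_nonneg mult_nonneg_nonneg mult_pos_pos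
        zero_le_power zero_less_power) auto
  finally show ?thesis by simp
qed

text \<open>\<open>AX_4^2 < AX_19^2\<close>, cleared of denominators and divided by
  \<open>p^2\<close>. After expansion the sides occur only through their squares and
  \<open>a*b\<close>, \<open>a*c\<close>, \<open>b*c\<close>.\<close>

lemma clawson_sq_gt_orthocenter_sq_poly:
  fixes a b c p q r :: real
  assumes "0 < r" "r \<le> q" "q < p"
    and pos: "0 < a" "0 < b" "0 < c"
    and sq: "a^2 = q + r" "b^2 = p + r" "c^2 = p + q"
  shows "a^2*(a*q*r + b*r*p + c*p*q)^2
    < (p*q+q*r+r*p)*(b*c*(b*c*(q^2+r^2) + 2*p*q*r))"
    (is "?L < ?R")
proof -
  obtain x y where rxy: "0 < r" "0 \<le> x" "0 < y" and pq: "p = r + x + y" "q = r + x"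
    using that[of "q - r" "p - q"] assms by auto
  have ab: "0 \<le> (a^2 + b^2)/2 - a*b" and ac: "0 \<le> (a^2 + c^2)/2 - a*c"
    using sum_squares_bound[of a b] sum_squares_bound[of a c] by auto
  have "b^2 \<le> c^2"
    using assms by simp
  then have "b \<le> c"
    using pos by (simp add: power2_le_iff_abs_le)
  then have bc: "0 \<le> b*c - b^2"
    using pos by (simp add: power2_eq_square)
  \<comment> \<open>The net coefficient of \<open>b*c\<close> is \<open>2*p*q*r\<close> times
    \<open>(p*q+q*r+r*p) - a^2*p = q*r\<close>, hence positive: \<open>b*c\<close> needs a lower
    bound, the other two products upper bounds.\<close>
  let ?E = "2*p*q*r*(a^2*r*((a^2 + b^2)/2 - a*b) + a^2*q*((a^2 + c^2)/2 - a*c)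
          + q*r*(b*c - b^2))"
  let ?F = "(p*q+q*r+r*p)*(b^2*c^2*(q^2+r^2) + 2*p*q*r*b^2)
        - a^2*(a^2*q^2*r^2 + b^2*p^2*r^2 + c^2*p^2*q^2
           + 2*p*q*r*((a^2+b^2)/2*r + (a^2+c^2)/2*q + b^2*p))"
  \<comment> \<open>\<open>?F\<close> is the difference with ab, ac and bc replaced by the bounds above, hence a polynomial in p, q, r.\<close>
  have "?R - ?L = ?E + ?F"
    using sq(1) by (simp add: field_simps) algebra
  moreover have "0 \<le> ?E"
    using assms by (intro mult_nonneg_nonneg add_nonneg_nonneg ab ac bc) auto
  moreover have "0 < ?F"
  proof -
    have "?F = r*x^5 + 2*r*x^4*y + r*x^3*y^2 + 5*r^2*x^4 + 10*r^2*x^3*y + 5*r^2*x^2*y^2 +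
      9*r^3*x^3 + 20*r^3*x^2*y + 8*r^3*x*y^2 + 7*r^4*x^2 + 18*r^4*x*y + 4*r^4*y^2 +
      2*r^5*x + 6*r^5*y"
      unfolding sq unfolding pq by (simp add: field_simps) algebra
    also have "\<dots> > 0"
      using rxy by (intro add_nonneg_pos add_nonneg_nonneg mult_nonneg_nonneg mult_pos_pos
          zero_le_power zero_less_power) auto
    finally show ?thesis .
  qed
  ultimately show ?thesis by linarith
qed

text \<open>Says \<open>AX_19^2 < 2*b^2*c^2/(2*p-q-r)\<close>, after division by \<open>b*c\<close>;
  the right side is a rational lower bound for \<open>AX_16^2\<close>.\<close>

lemma isodynamic_sq_gt_clawson_sq_poly:
  fixes a b c p q r :: real
  assumes "0 < r" "r \<le> q" "q < p"
    and pos: "0 < a" "0 < b" "0 < c"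
    and sq: "a^2 = q + r" "b^2 = p + r" "c^2 = p + q"
  shows "p^2*(b*c*(q^2+r^2) + 2*p*q*r)*(2*p-q-r) < 2*b*c*(a*q*r + b*r*p + c*p*q)^2"
proof -
  \<comment> \<open>Geometrically, \<open>p\<close> is \<open>b*c\<close> times the cosine of the
    angle at A.\<close>
  have "p^2 \<le> (b*c)^2"
    using assms unfolding power_mult_distrib sq by (simp add: power2_eq_square algebra_simps)
  then have bc: "p \<le> b*c"
    using pos by (simp add: power2_le_iff_abs_le)
  \<comment> \<open>Raising \<open>p\<close> to \<open>b*c\<close> in the mixed term completes the
    square \<open>(q+r)^2\<close>.\<close>
  have "p^2*(b*c*(q^2+r^2) + 2*p*q*r)*(2*p-q-r) \<le> p^2*(b*c*(q^2+r^2) + 2*(b*c)*q*r)*(2*p-q-r)"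
    using assms bc by (intro mult_right_mono mult_left_mono add_left_mono) auto
  also have "\<dots> = b*c*(p^2*(q+r)^2*(2*p-q-r))"
    by algebra
  also have "\<dots> < b*c*(2*p^3*(q+r)^2)"
    using assms by (intro mult_strict_left_mono) (auto simp: power3_eq_cube power2_eq_square)
  also have "\<dots> \<le> b*c*(2*(a*q*r + b*r*p + c*p*q)^2)"
  proof -
    have "p^3*(q+r)^2 = p*(p*r)^2 + p*(p*q)^2 + 2*p*(p*q*p*r)"
      by algebra
    \<comment> \<open>\<open>p\<close> is at most each of \<open>b^2\<close>, \<open>c^2\<close> and
      \<open>b*c\<close>.\<close>
    also have "\<dots> \<le> b^2*(p*r)^2 + c^2*(p*q)^2 + 2*(b*c)*(p*q*p*r)"
      using assms bc by (intro add_mono mult_right_mono mult_left_mono) auto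
    also have "\<dots> = (b*r*p + c*p*q)^2"
      by algebra
    also have "\<dots> \<le> (a*q*r + b*r*p + c*p*q)^2"
      using assms by (intro power_mono) (auto simp: add.assoc)
    finally show ?thesis
      using pos by (intro mult_left_mono) auto
  qed
  finally show ?thesis
    by (simp add: mult_ac)
qed

section \<open>Distances from the vertex to the centres\<close>

text \<open>With A as origin the weight \<open>u\<close> drops out of the numerator, and the law of
  cosines gives the mixed term.\<close>

lemma dist_bary_sq:
  assumes "u + v + w \<noteq> 0"
  shows "(dist A (bary A B C u v w))\<^sup>2 =
    ((dist A B)\<^sup>2 * v\<^sup>2 + (dist C A)\<^sup>2 * w\<^sup>2
      + ((dist C A)\<^sup>2 + (dist A B)\<^sup>2 - (dist B C)\<^sup>2) * v * w) / (u+v+w)\<^sup>2"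
proof -
  have "A - bary A B C u v w = (1/(u+v+w)) *\<^sub>R ((u+v+w) *\<^sub>R A - (u *\<^sub>R A + v *\<^sub>R B + w *\<^sub>R C))"
    using assms by (simp add: bary_def scaleR_diff_right)
  also have "\<dots> = (1/(u+v+w)) *\<^sub>R (v *\<^sub>R (A - B) + w *\<^sub>R (A - C))"
    by (simp add: algebra_simps)
  finally have "(dist A (bary A B C u v w))\<^sup>2
      = (norm (v *\<^sub>R (A - B) + w *\<^sub>R (A - C)))\<^sup>2 / (u+v+w)\<^sup>2"
    by (simp add: dist_norm power_divide)
  also have "(norm (v *\<^sub>R (A - B) + w *\<^sub>R (A - C)))\<^sup>2
      = (dist A B)\<^sup>2 * v\<^sup>2 + (dist C A)\<^sup>2 * w\<^sup>2
      + ((dist C A)\<^sup>2 + (dist A B)\<^sup>2 - (dist B C)\<^sup>2) * v * w"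
    unfolding dist_norm power2_norm_eq_inner
    by (simp add: inner_simps inner_commute algebra_simps power2_eq_square)
  finally show ?thesis .
qed

lemma bary_scale:
  assumes "k \<noteq> 0"
  shows "bary A B C (k*u) (k * v) (k * w) = bary A B C u v w"
proof -
  have "bary A B C (k*u) (k * v) (k * w)
      = (1/(k*(u+v+w))) *\<^sub>R (k *\<^sub>R (u *\<^sub>R A + v *\<^sub>R B + w *\<^sub>R C))"
    by (simp add: bary_def algebra_simps)
  then show ?thesis
    using assms by (simp add: bary_def)
qed

text \<open>Justifies assuming \<open>b \<le> c\<close>: each coordinate function is symmetric in
  its last two arguments.\<close>

lemma etc_center_swap: "etc_center n A C B = etc_center n A B C"
proof -
  have "conway_S a c b = conway_S a b c" for a b c
    unfolding conway_S_def by (rule arg_cong[where f = "\<lambda>x. sqrt x / 2"]) algebra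
  then have swap: "etc_coord n a c b = etc_coord n a b c" for a b c
    by (simp add: etc_coord_def add.commute)
  have "bary A C B u w v = bary A B C u v w" for u v w
    by (simp add: bary_def add_ac)
  then show ?thesis
    by (simp add: etc_center_def Let_def dist_commute swap)
qed

lemma frac_less_iff:
  fixes x y z w :: real
  assumes "0 < y" "0 < w"
  shows "x / y < z / w \<longleftrightarrow> x * w < z * y"
  using assms by (simp add: field_simps)

lemma dist_less_if_sq_less: "dist A X < dist A Y" if "(dist A X)\<^sup>2 < (dist A Y)\<^sup>2"
  using that by (rule power_less_imp_less_base) auto

text \<open>The parameters \<open>p\<close>, \<open>q\<close>, \<open>r\<close> are Conway's \<open>S\<^sub>A\<close>, \<open>S\<^sub>B\<close>, \<open>S\<^sub>C\<close>; the definition \<open>S\<close> below is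
  twice the area.\<close>

locale short_base_triangle =
  fixes A B C :: "real^2" and a b c p q r :: real
  assumes dists: "dist B C = a" "dist C A = b" "dist A B = c"
    and a_pos: "0 < a" and a_less_b: "a < b" and b_le_c: "b \<le> c"
    and acute: "c\<^sup>2 < a\<^sup>2 + b\<^sup>2"
    and conway: "p = (b\<^sup>2 + c\<^sup>2 - a\<^sup>2) / 2" "q = (c\<^sup>2 + a\<^sup>2 - b\<^sup>2) / 2"
      "r = (a\<^sup>2 + b\<^sup>2 - c\<^sup>2) / 2"
begin

section \<open>Signs and order of the sides and Conway parameters\<close>

lemma sides_pos: "0 < a" "0 < b" "0 < c"
  using a_pos a_less_b b_le_c by auto

lemma sides_sq: "a\<^sup>2 = q + r" "b\<^sup>2 = p + r" "c\<^sup>2 = p + q"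
  by (auto simp: conway field_simps)

lemma conway_double: "b\<^sup>2 + c\<^sup>2 - a\<^sup>2 = 2*p" "c\<^sup>2 + a\<^sup>2 - b\<^sup>2 = 2*q" "a\<^sup>2 + b\<^sup>2 - c\<^sup>2 = 2*r"
  by (auto simp: conway)

lemma conway_order: "0 < r" "r \<le> q" "q < p"
proof -
  have "a\<^sup>2 < b\<^sup>2" "b\<^sup>2 \<le> c\<^sup>2"
    using sides_pos a_less_b b_le_c by (auto intro!: power_strict_mono power_mono)
  then show "0 < r" "r \<le> q" "q < p"
    using acute by (auto simp: conway)
qed

lemma conway_pos: "0 < p" "0 < q" "0 < r"
  using conway_order by auto

lemma area_pos: "0 < p*q + q*r + r*p"
  using conway_pos by (simp add: add_pos_pos)

lemma heron: "(a+b+c)*(-a+b+c)*(a-b+c)*(a+b-c) = 4*(p*q + q*r + r*p)"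
  unfolding conway by (simp add: field_simps) algebra

section \<open>Closed forms of the squared distances\<close>

lemma dist_center:
  assumes "etc_center n A B C = bary A B C u v w" "u + v + w \<noteq> 0"
  shows "(dist A (etc_center n A B C))\<^sup>2 =
    (c\<^sup>2 * v\<^sup>2 + b\<^sup>2 * w\<^sup>2 + (b\<^sup>2 + c\<^sup>2 - a\<^sup>2) * v * w) / (u+v+w)\<^sup>2"
  using dist_bary_sq[OF assms(2)] by (simp add: assms(1) dists)

lemmas center_unfold = etc_center_def Let_def dists etc_coord_def

lemma dist_X1: "(dist A (etc_center 1 A B C))\<^sup>2 = b*c*(b+c-a) / (a+b+c)"
proof -
  have "(dist A (etc_center 1 A B C))\<^sup>2 =
      (c\<^sup>2*b\<^sup>2 + b\<^sup>2*c\<^sup>2 + (b\<^sup>2 + c\<^sup>2 - a\<^sup>2)*b*c) / (a+b+c)\<^sup>2"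
    by (rule dist_center) (use sides_pos in \<open>auto simp: center_unfold\<close>)
  \<comment> \<open>The left side is \<open>b*c*((b+c)^2 - a^2)\<close>.\<close>
  also have "c\<^sup>2*b\<^sup>2 + b\<^sup>2*c\<^sup>2 + (b\<^sup>2 + c\<^sup>2 - a\<^sup>2)*b*c = (b*c*(b+c-a)) * (a+b+c)"
    by algebra
  finally show ?thesis
    using sides_pos by (simp add: power2_eq_square)
qed

lemma dist_X2: "(dist A (etc_center 2 A B C))\<^sup>2 = (2*b\<^sup>2 + 2*c\<^sup>2 - a\<^sup>2) / 9"
  by (subst dist_center[of _ 1 1 1]) (auto simp: center_unfold)

text \<open>The squared circumradius; the denominator is 16 times the squared area.\<close>

lemma dist_X3: "(dist A (etc_center 3 A B C))\<^sup>2
    = a\<^sup>2*b\<^sup>2*c\<^sup>2 / ((a+b+c)*(-a+b+c)*(a-b+c)*(a+b-c))"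
proof -
  have "etc_center 3 A B C = bary A B C (2*(a\<^sup>2*p)) (2*(b\<^sup>2*q)) (2*(c\<^sup>2*r))"
    by (simp add: center_unfold conway_double mult_ac)
  then have "etc_center 3 A B C = bary A B C ((q+r)*p) ((p+r)*q) ((p+q)*r)"
    by (simp add: bary_scale sides_sq)
  then have "(dist A (etc_center 3 A B C))\<^sup>2 =
      (c\<^sup>2*((p+r)*q)\<^sup>2 + b\<^sup>2*((p+q)*r)\<^sup>2 + (b\<^sup>2 + c\<^sup>2 - a\<^sup>2)*((p+r)*q)*((p+q)*r))
        / ((q+r)*p + (p+r)*q + (p+q)*r)\<^sup>2"
    by (rule dist_center) (use area_pos in \<open>auto simp: algebra_simps\<close>)
  also have "c\<^sup>2*((p+r)*q)\<^sup>2 + b\<^sup>2*((p+q)*r)\<^sup>2 + (b\<^sup>2 + c\<^sup>2 - a\<^sup>2)*((p+r)*q)*((p+q)*r)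
      = (a\<^sup>2*b\<^sup>2*c\<^sup>2) * (p*q + q*r + r*p)"
    unfolding sides_sq by algebra
  also have "(q+r)*p + (p+r)*q + (p+q)*r = 2*(p*q + q*r + r*p)"
    by algebra
  finally have "(dist A (etc_center 3 A B C))\<^sup>2
      = (a\<^sup>2*b\<^sup>2*c\<^sup>2) * (p*q + q*r + r*p) / (2*(p*q + q*r + r*p))\<^sup>2" .
  also have "x*g / (2*g)\<^sup>2 = x / (4*g)" if "0 < g" for x g :: real
    using that by (simp add: power2_eq_square)
  note this[OF area_pos]
  finally show ?thesis
    unfolding heron .
qed

lemma dist_X4: "(dist A (etc_center 4 A B C))\<^sup>2 = a\<^sup>2*p\<^sup>2 / (p*q + q*r + r*p)"
proof -
  \<comment> \<open>Pulling out \<open>1/(2*p*q*r)\<close> replaces the reciprocal coordinates by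
    polynomial ones.\<close>
  have "etc_center 4 A B C
      = bary A B C (1/(2*p*q*r)*(q*r)) (1/(2*p*q*r)*(r*p)) (1/(2*p*q*r)*(p*q))"
    using conway_pos by (simp add: center_unfold sides_sq)
  then have "etc_center 4 A B C = bary A B C (q*r) (r*p) (p*q)"
    using conway_pos by (subst (asm) bary_scale) auto
  then have "(dist A (etc_center 4 A B C))\<^sup>2 =
      (c\<^sup>2*(r*p)\<^sup>2 + b\<^sup>2*(p*q)\<^sup>2 + (b\<^sup>2 + c\<^sup>2 - a\<^sup>2)*(r*p)*(p*q)) / (q*r + r*p + p*q)\<^sup>2"
    by (rule dist_center) (use area_pos in auto)
  also have "c\<^sup>2*(r*p)\<^sup>2 + b\<^sup>2*(p*q)\<^sup>2 + (b\<^sup>2 + c\<^sup>2 - a\<^sup>2)*(r*p)*(p*q)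
      = (a\<^sup>2*p\<^sup>2) * (p*q + q*r + r*p)"
    unfolding sides_sq by algebra
  also have "q*r + r*p + p*q = p*q + q*r + r*p"
    by simp
  finally show ?thesis
    using area_pos by (simp add: power2_eq_square)
qed

lemma dist_X6: "(dist A (etc_center 6 A B C))\<^sup>2
    = b\<^sup>2*c\<^sup>2*(2*b\<^sup>2 + 2*c\<^sup>2 - a\<^sup>2) / (a\<^sup>2 + b\<^sup>2 + c\<^sup>2)\<^sup>2"
proof -
  have "a\<^sup>2 + b\<^sup>2 + c\<^sup>2 > 0"
    using sides_pos by (intro add_pos_pos) auto
  then have "(dist A (etc_center 6 A B C))\<^sup>2 =
      (c\<^sup>2*(b\<^sup>2)\<^sup>2 + b\<^sup>2*(c\<^sup>2)\<^sup>2 + (b\<^sup>2 + c\<^sup>2 - a\<^sup>2)*b\<^sup>2*c\<^sup>2) / (a\<^sup>2 + b\<^sup>2 + c\<^sup>2)\<^sup>2"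
    by (intro dist_center) (auto simp: center_unfold)
  also have "c\<^sup>2*(b\<^sup>2)\<^sup>2 + b\<^sup>2*(c\<^sup>2)\<^sup>2 + (b\<^sup>2 + c\<^sup>2 - a\<^sup>2)*b\<^sup>2*c\<^sup>2
      = b\<^sup>2*c\<^sup>2*(2*b\<^sup>2 + 2*c\<^sup>2 - a\<^sup>2)"
    by algebra
  finally show ?thesis .
qed

lemma X9_sum_pos: "0 < 2*(a*b + b*c + c*a) - a\<^sup>2 - b\<^sup>2 - c\<^sup>2"
proof -
  \<comment> \<open>The triangle inequality for the longest side follows from acuteness:
    \<open>c^2 < a^2 + b^2 < (a+b)^2\<close>.\<close>
  have "c < a + b"
  proof (rule power_less_imp_less_base)
    have "0 < a*b"
      using sides_pos by simp
    then show "c\<^sup>2 < (a + b)\<^sup>2"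
      using acute by (simp add: power2_sum)
  qed (use sides_pos in auto)
  then have "0 < a*(b+c-a) + b*(c+a-b) + c*(a+b-c)"
    using sides_pos a_less_b b_le_c by (intro add_pos_pos mult_pos_pos) auto
  then show ?thesis
    by (simp add: power2_eq_square algebra_simps)
qed

lemma dist_X9: "(dist A (etc_center 9 A B C))\<^sup>2
    = b*c*(b*c*((c+a-b)\<^sup>2 + (a+b-c)\<^sup>2) + (b\<^sup>2+c\<^sup>2-a\<^sup>2)*(c+a-b)*(a+b-c))
      / (2*(a*b + b*c + c*a) - a\<^sup>2 - b\<^sup>2 - c\<^sup>2)\<^sup>2"
proof -
  have sum: "a*(b+c-a) + b*(c+a-b) + c*(a+b-c) = 2*(a*b + b*c + c*a) - a\<^sup>2 - b\<^sup>2 - c\<^sup>2"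
    by algebra
  have "(dist A (etc_center 9 A B C))\<^sup>2 =
      (c\<^sup>2*(b*(c+a-b))\<^sup>2 + b\<^sup>2*(c*(a+b-c))\<^sup>2 + (b\<^sup>2 + c\<^sup>2 - a\<^sup>2)*(b*(c+a-b))*(c*(a+b-c)))
        / (a*(b+c-a) + b*(c+a-b) + c*(a+b-c))\<^sup>2"
    by (rule dist_center) (use X9_sum_pos in \<open>auto simp: center_unfold sum\<close>)
  also have "c\<^sup>2*(b*(c+a-b))\<^sup>2 + b\<^sup>2*(c*(a+b-c))\<^sup>2 + (b\<^sup>2 + c\<^sup>2 - a\<^sup>2)*(b*(c+a-b))*(c*(a+b-c))
      = b*c*(b*c*((c+a-b)\<^sup>2 + (a+b-c)\<^sup>2) + (b\<^sup>2+c\<^sup>2-a\<^sup>2)*(c+a-b)*(a+b-c))"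
    by algebra
  finally show ?thesis
    by (simp only: sum)
qed

lemma dist_X10: "(dist A (etc_center 10 A B C))\<^sup>2
    = (c\<^sup>2*(c+a)\<^sup>2 + b\<^sup>2*(a+b)\<^sup>2 + (b\<^sup>2+c\<^sup>2-a\<^sup>2)*(c+a)*(a+b)) / (4*(a+b+c)\<^sup>2)"
proof -
  have "(dist A (etc_center 10 A B C))\<^sup>2
      = (c\<^sup>2*(c+a)\<^sup>2 + b\<^sup>2*(a+b)\<^sup>2 + (b\<^sup>2+c\<^sup>2-a\<^sup>2)*(c+a)*(a+b)) / ((b+c)+(c+a)+(a+b))\<^sup>2"
    by (rule dist_center) (use sides_pos in \<open>auto simp: center_unfold\<close>)
  also have "((b+c)+(c+a)+(a+b))\<^sup>2 = 4*(a+b+c)\<^sup>2"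
    by algebra
  finally show ?thesis .
qed

lemma X19_sum_pos: "0 < a*q*r + b*r*p + c*p*q"
  using conway_pos sides_pos by (intro add_pos_pos mult_pos_pos)

lemma dist_X19: "(dist A (etc_center 19 A B C))\<^sup>2
    = p\<^sup>2*(b*c*(b*c*(q\<^sup>2+r\<^sup>2) + 2*p*q*r)) / (a*q*r + b*r*p + c*p*q)\<^sup>2"
proof -
  have "etc_center 19 A B C
      = bary A B C (1/(2*p*q*r)*(a*q*r)) (1/(2*p*q*r)*(b*r*p)) (1/(2*p*q*r)*(c*p*q))"
    using conway_pos by (simp add: center_unfold sides_sq)
  then have "etc_center 19 A B C = bary A B C (a*q*r) (b*r*p) (c*p*q)"
    using conway_pos by (subst (asm) bary_scale) auto
  then have "(dist A (etc_center 19 A B C))\<^sup>2 =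
      (c\<^sup>2*(b*r*p)\<^sup>2 + b\<^sup>2*(c*p*q)\<^sup>2 + (b\<^sup>2 + c\<^sup>2 - a\<^sup>2)*(b*r*p)*(c*p*q))
        / (a*q*r + b*r*p + c*p*q)\<^sup>2"
    by (rule dist_center) (use X19_sum_pos in auto)
  also have "b\<^sup>2 + c\<^sup>2 - a\<^sup>2 = 2*p"
    by (simp add: conway)
  also have "c\<^sup>2*(b*r*p)\<^sup>2 + b\<^sup>2*(c*p*q)\<^sup>2 + 2*p*(b*r*p)*(c*p*q)
      = p\<^sup>2*(b*c*(b*c*(q\<^sup>2+r\<^sup>2) + 2*p*q*r))"
    by algebra
  finally show ?thesis .
qed

section \<open>The second isodynamic point X_16\<close>

definition S :: real where "S = sqrt (p*q + q*r + r*p)"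

lemma S_pos: "0 < S"
  using area_pos by (simp add: S_def)

lemma S_sq: "S\<^sup>2 = p*q + q*r + r*p"
  using area_pos by (simp add: S_def)

lemma conway_S_eq: "conway_S a b c = S" "conway_S b c a = S" "conway_S c a b = S"
proof -
  have *: "conway_S a b c = S"
    unfolding conway_S_def heron S_def real_sqrt_mult by simp
  moreover have "conway_S b c a = conway_S a b c" "conway_S c a b = conway_S a b c"
    unfolding conway_S_def by (rule arg_cong[where f = "\<lambda>x. sqrt x / 2"], algebra)+
  ultimately show "conway_S a b c = S" "conway_S b c a = S" "conway_S c a b = S"
    by simp_all
qed

text \<open>Keeps the denominator of \<open>AX_16^2\<close> positive; strict because
  \<open>q < p\<close>.\<close>

lemma weitzenboeck: "sqrt 3 * S < p + q + r"
proof (rule power_less_imp_less_base)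
  have "0 < (p - q)\<^sup>2 + (q - r)\<^sup>2 + (r - p)\<^sup>2"
    using conway_order by (intro add_pos_nonneg) auto
  also have "\<dots> = 2 * ((p + q + r)\<^sup>2 - (sqrt 3 * S)\<^sup>2)"
    unfolding power_mult_distrib S_sq by (simp add: power2_eq_square algebra_simps)
  finally show "(sqrt 3 * S)\<^sup>2 < (p + q + r)\<^sup>2"
    by simp
qed (use conway_pos in simp)

text \<open>A rational bound for \<open>sqrt 3 * S\<close>; the constant is the one giving equality
  at \<open>p = q = r\<close>, the equilateral limit.\<close>

lemma S_lower: "3/2*(q+r) \<le> sqrt 3 * S"
proof (rule power2_le_imp_le)
  have "q*q \<le> p*q" "q*r \<le> p*r" "r*r \<le> q*q" "r*r \<le> q*r"
    using conway_order by (intro mult_mono; simp)+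
  then have "9/4*(q+r)\<^sup>2 \<le> 3*(p*q + q*r + r*p)"
    by (simp add: power2_eq_square algebra_simps)
  then show "(3/2*(q+r))\<^sup>2 \<le> (sqrt 3 * S)\<^sup>2"
    unfolding power_mult_distrib S_sq by (simp add: power_divide)
qed (use S_pos in simp)

lemma dist_X16: "(dist A (etc_center 16 A B C))\<^sup>2 = b\<^sup>2*c\<^sup>2 / (p + q + r - sqrt 3 * S)"
proof -
  define k where "k = p + q + r - sqrt 3 * S"
  have "0 < k"
    using weitzenboeck by (simp add: k_def)
  define h :: real where "h = sqrt 3"
  have h: "h\<^sup>2 = 3" and k: "k = p + q + r - h*S"
    by (simp_all add: h_def k_def)
  have sum: "a\<^sup>2*(h*p - S) + b\<^sup>2*(h*q - S) + c\<^sup>2*(h*r - S) = -2*S*k"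
    using S_sq unfolding sides_sq k by algebra
  have "(dist A (etc_center 16 A B C))\<^sup>2 =
      (c\<^sup>2*(b\<^sup>2*(h*q - S))\<^sup>2 + b\<^sup>2*(c\<^sup>2*(h*r - S))\<^sup>2
        + (b\<^sup>2 + c\<^sup>2 - a\<^sup>2)*(b\<^sup>2*(h*q - S))*(c\<^sup>2*(h*r - S)))
        / (a\<^sup>2*(h*p - S) + b\<^sup>2*(h*q - S) + c\<^sup>2*(h*r - S))\<^sup>2"
  proof (rule dist_center)
    show "etc_center 16 A B C = bary A B C (a\<^sup>2*(h*p - S)) (b\<^sup>2*(h*q - S)) (c\<^sup>2*(h*r - S))"
      by (simp add: center_unfold conway_S_eq conway_double h_def)
  qed (use sum S_pos \<open>0 < k\<close> in auto)
  also have "c\<^sup>2*(b\<^sup>2*(h*q - S))\<^sup>2 + b\<^sup>2*(c\<^sup>2*(h*r - S))\<^sup>2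
        + (b\<^sup>2 + c\<^sup>2 - a\<^sup>2)*(b\<^sup>2*(h*q - S))*(c\<^sup>2*(h*r - S)) = (b\<^sup>2*c\<^sup>2)*(4*S\<^sup>2*k)"
  proof -
    have "b\<^sup>2*(h*q - S)\<^sup>2 + c\<^sup>2*(h*r - S)\<^sup>2 + (b\<^sup>2 + c\<^sup>2 - a\<^sup>2)*(h*q - S)*(h*r - S) = 4*S\<^sup>2*k"
    proof -
      have e1: "(p+r)*q\<^sup>2 + (p+q)*r\<^sup>2 + 2*p*q*r = (q+r)*S\<^sup>2"
        and e2: "(p+r)*q + (p+q)*r + p*(q+r) = 2*S\<^sup>2"
        unfolding S_sq by algebra+
      have "b\<^sup>2*(h*q - S)\<^sup>2 + c\<^sup>2*(h*r - S)\<^sup>2 + (b\<^sup>2 + c\<^sup>2 - a\<^sup>2)*(h*q - S)*(h*r - S)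
        = h\<^sup>2*((p+r)*q\<^sup>2 + (p+q)*r\<^sup>2 + 2*p*q*r)
          - 2*h*S*((p+r)*q + (p+q)*r + p*(q+r)) + S\<^sup>2*(4*p + q + r)"
        unfolding sides_sq by algebra
      \<comment> \<open>\<open>h^2 = 3\<close> is what makes this collapse:
        \<open>3*(q+r) + (4*p+q+r) = 4*(p+q+r)\<close>.\<close>
      also have "\<dots> = 4*S\<^sup>2*k"
        unfolding e1 e2 h k by algebra
      finally show ?thesis .
    qed
    moreover have "c\<^sup>2*(b\<^sup>2*(h*q - S))\<^sup>2 + b\<^sup>2*(c\<^sup>2*(h*r - S))\<^sup>2
        + (b\<^sup>2 + c\<^sup>2 - a\<^sup>2)*(b\<^sup>2*(h*q - S))*(c\<^sup>2*(h*r - S)) = (b\<^sup>2*c\<^sup>2) *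
        (b\<^sup>2*(h*q - S)\<^sup>2 + c\<^sup>2*(h*r - S)\<^sup>2 + (b\<^sup>2 + c\<^sup>2 - a\<^sup>2)*(h*q - S)*(h*r - S))"
      by algebra
    ultimately show ?thesis by simp
  qed
  finally show ?thesis
    using S_pos \<open>0 < k\<close> unfolding sum k_def[symmetric] by (simp add: power2_eq_square)
qed

section \<open>The eight comparisons\<close>

lemmas side_order = a_pos a_less_b b_le_c acute

lemma X3_less_X9: "dist A (etc_center 3 A B C) < dist A (etc_center 9 A B C)"
proof (rule dist_less_if_sq_less)
  \<comment> \<open>Restores the factor \<open>b*c\<close> cancelled in the polynomial
    inequality.\<close>
  have "b*c*(a\<^sup>2*b*c*(2*(a*b + b*c + c*a) - a\<^sup>2 - b\<^sup>2 - c\<^sup>2)\<^sup>2)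
    < b*c*(((a+b+c)*(-a+b+c)*(a-b+c)*(a+b-c))
      * (b*c*((c+a-b)\<^sup>2 + (a+b-c)\<^sup>2) + (b\<^sup>2+c\<^sup>2-a\<^sup>2)*(c+a-b)*(a+b-c)))"
    using mittenpunkt_sq_gt_poly[OF side_order] sides_pos by (intro mult_strict_left_mono) auto
  moreover have "0 < (a+b+c)*(-a+b+c)*(a-b+c)*(a+b-c)"
    using area_pos unfolding heron by simp
  moreover have "0 < (2*(a*b + b*c + c*a) - a\<^sup>2 - b\<^sup>2 - c\<^sup>2)\<^sup>2"
    using X9_sum_pos by simp
  ultimately show "(dist A (etc_center 3 A B C))\<^sup>2 < (dist A (etc_center 9 A B C))\<^sup>2"
    unfolding dist_X3 dist_X9 by (subst frac_less_iff) (simp_all only: power2_eq_square mult_ac)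
qed

lemma X9_less_X10: "dist A (etc_center 9 A B C) < dist A (etc_center 10 A B C)"
proof (rule dist_less_if_sq_less)
  have "0 < (2*(a*b + b*c + c*a) - a\<^sup>2 - b\<^sup>2 - c\<^sup>2)\<^sup>2" "0 < 4*(a+b+c)\<^sup>2"
    using X9_sum_pos sides_pos by simp_all
  then show "(dist A (etc_center 9 A B C))\<^sup>2 < (dist A (etc_center 10 A B C))\<^sup>2"
    unfolding dist_X9 dist_X10
    using spieker_sq_gt_mittenpunkt_sq_poly[OF side_order] by (subst frac_less_iff)
qed

lemma X10_less_X2: "dist A (etc_center 10 A B C) < dist A (etc_center 2 A B C)"
proof (rule dist_less_if_sq_less)
  have "0 < 4*(a+b+c)\<^sup>2"
    using sides_pos by simp
  then show "(dist A (etc_center 10 A B C))\<^sup>2 < (dist A (etc_center 2 A B C))\<^sup>2"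
    unfolding dist_X10 dist_X2
    using centroid_sq_gt_spieker_sq_poly[OF side_order]
    by (subst frac_less_iff) (simp_all only: mult_ac zero_less_numeral)
qed

lemma X2_less_X1: "dist A (etc_center 2 A B C) < dist A (etc_center 1 A B C)"
proof (rule dist_less_if_sq_less)
  show "(dist A (etc_center 2 A B C))\<^sup>2 < (dist A (etc_center 1 A B C))\<^sup>2"
    unfolding dist_X2 dist_X1
    using incenter_sq_gt_centroid_sq_poly[OF side_order] sides_pos
    by (subst frac_less_iff) (simp_all add: mult.commute)
qed

lemma X1_less_X6: "dist A (etc_center 1 A B C) < dist A (etc_center 6 A B C)"
proof (rule dist_less_if_sq_less)
  have "b*c*((b+c-a)*(a\<^sup>2+b\<^sup>2+c\<^sup>2)\<^sup>2) < b*c*(b*c*(2*b\<^sup>2 + 2*c\<^sup>2 - a\<^sup>2)*(a+b+c))"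
    using symmedian_sq_gt_incenter_sq_poly[OF side_order] sides_pos
    by (intro mult_strict_left_mono) auto
  moreover have "0 < (a\<^sup>2+b\<^sup>2+c\<^sup>2)\<^sup>2" "0 < a + b + c"
    using sides_pos by (intro zero_less_power add_pos_pos; simp)+
  ultimately show "(dist A (etc_center 1 A B C))\<^sup>2 < (dist A (etc_center 6 A B C))\<^sup>2"
    unfolding dist_X1 dist_X6 by (subst frac_less_iff) (simp_all only: power2_eq_square mult_ac)
qed

lemma X6_less_X4: "dist A (etc_center 6 A B C) < dist A (etc_center 4 A B C)"
proof (rule dist_less_if_sq_less)
  have "b\<^sup>2*c\<^sup>2*(2*b\<^sup>2 + 2*c\<^sup>2 - a\<^sup>2) = (p+r)*(p+q)*(4*p+q+r)"
       "(a\<^sup>2 + b\<^sup>2 + c\<^sup>2)\<^sup>2 = 4*(p+q+r)\<^sup>2"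
    unfolding sides_sq by algebra+
  moreover have "0 < 4*(p+q+r)\<^sup>2"
    using conway_pos by simp
  ultimately show "(dist A (etc_center 6 A B C))\<^sup>2 < (dist A (etc_center 4 A B C))\<^sup>2"
    unfolding dist_X6 dist_X4
    using orthocenter_sq_gt_symmedian_sq_poly[OF conway_order] area_pos
    by (simp only: frac_less_iff) (simp only: sides_sq)
qed

lemma X4_less_X19: "dist A (etc_center 4 A B C) < dist A (etc_center 19 A B C)"
proof (rule dist_less_if_sq_less)
  have "p\<^sup>2*(a\<^sup>2*(a*q*r + b*r*p + c*p*q)\<^sup>2)
      < p\<^sup>2*((p*q+q*r+r*p)*(b*c*(b*c*(q\<^sup>2+r\<^sup>2) + 2*p*q*r)))"
    using clawson_sq_gt_orthocenter_sq_poly[OF conway_order sides_pos sides_sq] conway_pos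
    by (intro mult_strict_left_mono) auto
  moreover have "0 < (a*q*r + b*r*p + c*p*q)\<^sup>2"
    using X19_sum_pos by simp
  ultimately show "(dist A (etc_center 4 A B C))\<^sup>2 < (dist A (etc_center 19 A B C))\<^sup>2"
    unfolding dist_X4 dist_X19 using area_pos
    by (subst frac_less_iff) (simp_all only: power2_eq_square mult_ac)
qed

lemma X19_less_X16: "dist A (etc_center 19 A B C) < dist A (etc_center 16 A B C)"
proof (rule dist_less_if_sq_less)
  have "b*c*(p\<^sup>2*(b*c*(q\<^sup>2+r\<^sup>2) + 2*p*q*r)*(2*p-q-r))
      < b*c*(2*b*c*(a*q*r + b*r*p + c*p*q)\<^sup>2)"
    using isodynamic_sq_gt_clawson_sq_poly[OF conway_order sides_pos sides_sq] sides_pos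
    by (intro mult_strict_left_mono) auto
  moreover have "0 < (a*q*r + b*r*p + c*p*q)\<^sup>2"
    using X19_sum_pos by simp
  moreover have "0 < (2*p-q-r)/2"
    using conway_order by simp
  \<comment> \<open>The intermediate denominator is \<open>p + q + r - 3/2*(q+r)\<close>, from
    \<open>S_lower\<close>.\<close>
  ultimately have "(dist A (etc_center 19 A B C))\<^sup>2 < b\<^sup>2*c\<^sup>2 / ((2*p-q-r)/2)"
    unfolding dist_X19 by (subst frac_less_iff) (simp_all add: power2_eq_square mult_ac)
  also have "\<dots> \<le> b\<^sup>2*c\<^sup>2 / (p + q + r - sqrt 3 * S)"
  proof (intro divide_left_mono mult_pos_pos)
    show "p + q + r - sqrt 3 * S \<le> (2*p-q-r)/2"
      using S_lower by simp
  qed (use weitzenboeck conway_order in auto)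
  finally show "(dist A (etc_center 19 A B C))\<^sup>2 < (dist A (etc_center 16 A B C))\<^sup>2"
    unfolding dist_X16 .
qed

end

section \<open>Reduction of the general triangle to \<open>b \<le> c\<close>\<close>

theorem theorem4p1:
  fixes A B C :: "real^2"
  assumes "acute_triangle A B C"
    and "dist B C < dist C A" and "dist B C < dist A B"
  shows "dist A (etc_center 3 A B C) < dist A (etc_center 9 A B C) \<and>
         dist A (etc_center 9 A B C) < dist A (etc_center 10 A B C) \<and>
         dist A (etc_center 10 A B C) < dist A (etc_center 2 A B C) \<and>
         dist A (etc_center 2 A B C) < dist A (etc_center 1 A B C) \<and>
         dist A (etc_center 1 A B C) < dist A (etc_center 6 A B C) \<and>
         dist A (etc_center 6 A B C) < dist A (etc_center 4 A B C) \<and>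
         dist A (etc_center 4 A B C) < dist A (etc_center 19 A B C) \<and>
         dist A (etc_center 19 A B C) < dist A (etc_center 16 A B C)"
proof -
  have "B \<noteq> C"
    using assms(1) by (auto simp: acute_triangle_def)
  have acute: "(dist C A)\<^sup>2 < (dist A B)\<^sup>2 + (dist B C)\<^sup>2"
    "(dist A B)\<^sup>2 < (dist B C)\<^sup>2 + (dist C A)\<^sup>2"
    using assms(1) unfolding acute_triangle_def by blast+
  show ?thesis
  proof (cases "dist C A \<le> dist A B")
    case True
    interpret short_base_triangle A B C "dist B C" "dist C A" "dist A B"
      "((dist C A)\<^sup>2 + (dist A B)\<^sup>2 - (dist B C)\<^sup>2) / 2"
      "((dist A B)\<^sup>2 + (dist B C)\<^sup>2 - (dist C A)\<^sup>2) / 2"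
      "((dist B C)\<^sup>2 + (dist C A)\<^sup>2 - (dist A B)\<^sup>2) / 2"
      by (rule short_base_triangle.intro) (use True assms(2,3) acute \<open>B \<noteq> C\<close> in simp_all)
    show ?thesis
      using X3_less_X9 X9_less_X10 X10_less_X2 X2_less_X1 X1_less_X6 X6_less_X4 X4_less_X19
        X19_less_X16 by blast
  next
    case False
    \<comment> \<open>Here \<open>c < b\<close>, so B and C exchange roles; the centres are
      unaffected by \<open>etc_center_swap\<close>.\<close>
    interpret short_base_triangle A C B "dist C B" "dist B A" "dist A C"
      "((dist B A)\<^sup>2 + (dist A C)\<^sup>2 - (dist C B)\<^sup>2) / 2"
      "((dist A C)\<^sup>2 + (dist C B)\<^sup>2 - (dist B A)\<^sup>2) / 2"
      "((dist C B)\<^sup>2 + (dist B A)\<^sup>2 - (dist A C)\<^sup>2) / 2"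
      by (rule short_base_triangle.intro)
        (use False assms(2,3) acute \<open>B \<noteq> C\<close> in \<open>simp_all add: dist_commute add.commute\<close>)
    show ?thesis
      using X3_less_X9 X9_less_X10 X10_less_X2 X2_less_X1 X1_less_X6 X6_less_X4 X4_less_X19
        X19_less_X16 unfolding etc_center_swap[of _ A C B] by blast
  qed
qed

end
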